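(* Let $T=\{0,\dots,N\}$ and $\mathbb{F}$ a field. Let $C_\bullet$, $C'_\bullet$ be filtrations of finite-dimensional chain complexes $C$, $C'$ over $\mathbb{F}$ with filtration compatible ordered bases $\mathfrak{C}=(c_1,\dots,c_n)$, $\mathfrak{C}'=(c'_1,\dots,c'_n)$ and filtration boundary matrices $D$, $D'$. Let $\varphi_\bullet\colon C_\bullet\to C'_\bullet$ be an injective morphism of filtrations of chain complexes with $\varphi=\varphi_N$ an isomorphism, $F$ its matrix with respect to $\mathfrak{C},\mathfrak{C}'$, and $D^{\varphi}=DF^{-1}=F^{-1}D'$. Let $V$, $V^{\varphi}$ be invertible upper-triangular matrices such that $R=DV$ and $R^{\varphi}=D^{\varphi}V^{\varphi}$ are reduced; interpret columns of $R,V,R^{\varphi}$ as coordinate vectors with respect to $\mathfrak{C}$ (elements of $C$) and columns of $FR^{\varphi}$ and $FV$ as coordinate vectors with respect to $\mathfrak{C}'$ (elements of $C'$). Then the family \[ \mathfrak{Z}=\operatorname{cols}FR^{\varphi}\cup\{Fv_j\mid r_j=0 \text{ and } j\notin\operatorname{pivs}R^{\varphi}\} \] is a filtration compatible basis for the filtration $\varphi_\bullet(Z_*(C_\bullet))$, $t\mapsto\varphi_t(\ker\partial|_{C_t})$, and for all $z\in\mathfrak{Z}$, \[ \operatorname{supp}_{\varphi_\bullet(Z_*(C_\bullet))}(z)=\operatorname{supp}_{C_\bullet}(F^{-1}z). \]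
   Context: A chain complex is a finite-dimensional graded vector space with differential $\partial$ of degree $-1$, $\partial^2=0$; a filtration of chain complexes is a chain of subcomplexes $C_0\subseteq\dots\subseteq C_N=C$. Support: $\operatorname{supp}_{M_\bullet}(m)=\{t\mid m\in M_t\}$. A basis $\mathfrak{M}$ of $M_N$ is filtration compatible if $\mathfrak{M}\cap M_t$ is a basis of $M_t$ for all $t$; an ordered such basis is a filtration compatible ordered basis if $m\le m'$ implies $\operatorname{supp}(m')\subseteq\operatorname{supp}(m)$. The filtration boundary matrix is the matrix of $\partial$ in that basis. For a matrix $X$, $x_j$ is its $j$-th column, $\operatorname{cols}X$ the family of its nonzero columns; $\operatorname{piv}x_j$ is the largest row index of a nonzero entry of a nonzero column; $\operatorname{pivs}X$ is the set of all pivots of nonzero columns; $X$ is reduced if no two nonzero columns have the same pivot. *)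

theory Defs
  imports "HOL-Analysis.Analysis"
begin

text \<open>Coordinates: a finite-dimensional space with an ordered basis (c_1,...,c_n) is
  represented as 'a^'n, the basis being the standard basis axis j 1, ordered by the
  linear order on the finite index type 'n. Linear maps are given by their matrices
  (type 'a^'n^'n, entry A$i$j = row i, column j). The time index set is T = {0..N}.\<close>

definition chain_complex :: "('a::field)^'n^'n \<Rightarrow> bool" where
  "chain_complex D \<longleftrightarrow> D ** D = 0"

text \<open>A filtration of chain complexes C_0 \<subseteq> ... \<subseteq> C_N = C by subcomplexes
  (differential x \<mapsto> D *v x).\<close>
definition filtration_cc :: "nat \<Rightarrow> ('a::field)^'n^'n \<Rightarrow> (nat \<Rightarrow> ('a^'n) set) \<Rightarrow> bool" where
  "filtration_cc N D C \<longleftrightarrow> chain_complex D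
     \<and> (\<forall>t\<le>N. vec.subspace (C t) \<and> (\<forall>x\<in>C t. D *v x \<in> C t))
     \<and> (\<forall>t<N. C t \<subseteq> C (Suc t)) \<and> C N = UNIV"

definition supp :: "nat \<Rightarrow> (nat \<Rightarrow> 'v set) \<Rightarrow> 'v \<Rightarrow> nat set" where
  "supp N M m = {t. t \<le> N \<and> m \<in> M t}"

text \<open>A family b indexed by I is a filtration compatible basis of the filtration M:
  it is a basis of M_N and its subfamily of members lying in M_t is a basis of M_t.\<close>
definition filt_compat_basis ::
  "nat \<Rightarrow> (nat \<Rightarrow> ('a::field^'n) set) \<Rightarrow> 'i set \<Rightarrow> ('i \<Rightarrow> 'a^'n) \<Rightarrow> bool" where
  "filt_compat_basis N M I b \<longleftrightarrow> inj_on b I \<and>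
     (\<forall>t\<le>N. vec.independent (b ` {i\<in>I. b i \<in> M t}) \<and> vec.span (b ` {i\<in>I. b i \<in> M t}) = M t)"

definition filt_compat_ordered_basis ::
  "nat \<Rightarrow> (nat \<Rightarrow> ('a::field^'n::{finite,linorder}) set) \<Rightarrow> ('n::{finite,linorder} \<Rightarrow> 'a^'n::{finite,linorder}) \<Rightarrow> bool" where
  "filt_compat_ordered_basis N M b \<longleftrightarrow> filt_compat_basis N M UNIV b \<and>
     (\<forall>j j'. j \<le> j' \<longrightarrow> supp N M (b j') \<subseteq> supp N M (b j))"

text \<open>Injective morphism of filtrations of chain complexes, given by the matrix F of
  \<phi> = \<phi>_N; \<phi>_t is the restriction of \<phi> to C_t.\<close>
definition inj_filt_morphism ::
  "nat \<Rightarrow> ('a::field)^'n^'n \<Rightarrow> (nat \<Rightarrow> ('a^'n) set) \<Rightarrow> 'a^'n^'n \<Rightarrow> (nat \<Rightarrow> ('a^'n) set)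
    \<Rightarrow> 'a^'n^'n \<Rightarrow> bool" where
  "inj_filt_morphism N D C D' C' F \<longleftrightarrow> F ** D = D' ** F
     \<and> (\<forall>t\<le>N. (\<forall>x\<in>C t. F *v x \<in> C' t) \<and> inj_on ((*v) F) (C t))"

definition piv :: "('a::zero)^'n::{finite,linorder} \<Rightarrow> 'n" where
  "piv x = Max {i. x $ i \<noteq> 0}"

definition pivs :: "('a::zero)^'n^'m::{finite,linorder} \<Rightarrow> 'm set" where
  "pivs X = {piv (column j X) | j. column j X \<noteq> 0}"

definition reduced :: "('a::zero)^'n^'m::{finite,linorder} \<Rightarrow> bool" where
  "reduced X \<longleftrightarrow> (\<forall>j k. column j X \<noteq> 0 \<longrightarrow> column k X \<noteq> 0 \<longrightarrow>
      piv (column j X) = piv (column k X) \<longrightarrow> j = k)"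

definition upper_triangular :: "('a::zero)^'n::{finite,linorder}^'n::{finite,linorder} \<Rightarrow> bool" where
  "upper_triangular V \<longleftrightarrow> (\<forall>i j. j < i \<longrightarrow> V $ i $ j = 0)"

end

theory Submission
  imports Defs
begin

(*
  Pull everything back along the isomorphism F: the family F^-1 z consists of the columns of
  R\<phi> = D F^-1 V\<phi> and the columns v_j of V with r_j = 0, j not a pivot of R\<phi>. All of them are
  cycles of D, and their pivots are pairwise distinct (R\<phi> is reduced, v_j has pivot j), hence
  they are independent. For a filtration compatible ordered standard basis, membership in C_t
  depends only on the pivot. Every nonzero cycle x = V y has the pivot of y, which indexes a zero
  column of the reduced matrix R = D V; so its pivot is the pivot of some member of the family,
  and eliminating pivots shows that the members lying in C_t span the cycles of C_t. Finally F is
  injective and linear, so it carries these bases to bases and preserves supports.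
*)

lemma matrix_inv_inverse:
  fixes A :: "'a::field^'n^'n"
  assumes "invertible A"
  shows "A ** matrix_inv A = mat 1" and "matrix_inv A ** A = mat 1"
  using someI_ex[OF assms[unfolded invertible_def]] unfolding matrix_inv_def by auto

lemma column_matrix_matrix_mult: "column j (A ** B) = A *v column j (B::'a::comm_semiring_1^'n^'m)"
  by (simp add: column_def matrix_matrix_mult_def matrix_vector_mult_def vec_eq_iff)

lemma column_eq_mult_axis: "column j A = A *v axis j (1::'a::comm_semiring_1)"
  by (simp add: vec_eq_iff column_def matrix_vector_mult_def axis_def if_distrib cong: if_cong)

lemma piv_nonzero:
  fixes x :: "'a::zero^'n::{finite,linorder}"
  assumes "x \<noteq> 0"
  shows "x $ piv x \<noteq> 0"
proof -
  have "{i. x $ i \<noteq> 0} \<noteq> {}" using assms by (auto simp: vec_eq_iff)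
  then show ?thesis unfolding piv_def using Max_in[of "{i. x $ i \<noteq> 0}"] by auto
qed

lemma le_piv:
  fixes x :: "'a::zero^'n::{finite,linorder}"
  shows "x $ k \<noteq> 0 \<Longrightarrow> k \<le> piv x"
  unfolding piv_def by (rule Max_ge) auto

lemma nth_eq_0_if_piv_less:
  fixes x :: "'a::zero^'n::{finite,linorder}"
  shows "piv x < k \<Longrightarrow> x $ k = 0"
  using le_piv[of x k] by fastforce

lemma piv_eqI:
  fixes x :: "'a::zero^'n::{finite,linorder}"
  assumes "x $ m \<noteq> 0" and "\<And>k. m < k \<Longrightarrow> x $ k = 0"
  shows "piv x = m"
  unfolding piv_def by (rule Max_eqI) (use assms in \<open>auto simp: not_less[symmetric]\<close>)

lemma piv_axis [simp]: "piv (axis j (1::'a::zero_neq_one) :: 'a^'n::{finite,linorder}) = j"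
  by (rule piv_eqI) (auto simp: axis_def)

lemma distinct_pivots_lincomb_eq_0:
  fixes f :: "'j \<Rightarrow> 'a::field^'n::{finite,linorder}"
  assumes "finite J" and nonzero: "\<And>l. l \<in> J \<Longrightarrow> f l \<noteq> 0"
    and inj: "inj_on (\<lambda>l. piv (f l)) J"
    and sum: "(\<Sum>l\<in>J. c l *s f l) = 0"
  shows "\<forall>l\<in>J. c l = 0"
proof (rule ccontr)
  assume "\<not> (\<forall>l\<in>J. c l = 0)"
  define P where "P = (\<lambda>l. piv (f l)) ` {l\<in>J. c l \<noteq> 0}"
  have "finite P" "P \<noteq> {}"
    using \<open>finite J\<close> \<open>\<not> (\<forall>l\<in>J. c l = 0)\<close> by (auto simp: P_def)
  then have "Max P \<in> P" by (rule Max_in)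
  then obtain l0 where l0: "l0 \<in> J" "c l0 \<noteq> 0" "Max P = piv (f l0)"
    unfolding P_def by auto
  have top: "piv (f l) \<le> piv (f l0)" if "l \<in> J" "c l \<noteq> 0" for l
    unfolding l0(3)[symmetric] using that \<open>finite P\<close> by (intro Max_ge) (auto simp: P_def)
  let ?p = "piv (f l0)"
  have others: "c l * f l $ ?p = 0" if "l \<in> J - {l0}" for l
  proof (cases "c l = 0")
    case False
    with that top have "piv (f l) \<le> ?p" by blast
    moreover have "piv (f l) \<noteq> ?p" using inj that l0 by (auto simp: inj_on_def)
    ultimately show ?thesis by (simp add: nth_eq_0_if_piv_less)
  qed simp
  have "0 = (\<Sum>l\<in>J. c l * f l $ ?p)" using sum by (simp add: vec_eq_iff)
  also have "\<dots> = c l0 * f l0 $ ?p"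
    using \<open>finite J\<close> l0(1) others by (simp add: sum.remove[of J l0] sum.neutral)
  finally show False using l0 nonzero piv_nonzero by auto
qed

lemma independent_distinct_pivots:
  fixes B :: "('a::field^'n::{finite,linorder}) set"
  assumes "0 \<notin> B" and "inj_on piv B"
  shows "vec.independent B"
  unfolding vec.independent_explicit_module
proof (intro allI impI)
  fix T u v
  assume T: "finite T" "T \<subseteq> B" "(\<Sum>v\<in>T. u v *s v) = 0" and "v \<in> T"
  have "inj_on piv T" using assms(2) T(2) by (rule inj_on_subset)
  with T assms(1) have "\<forall>v\<in>T. u v = 0"
    by (intro distinct_pivots_lincomb_eq_0[of T "\<lambda>v. v"]) auto
  then show "u v = 0" using \<open>v \<in> T\<close> by blast
qed

lemma nth_pivot_elimination_eq_0:
  fixes x b :: "'a::field^'n::{finite,linorder}"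
  assumes "b \<noteq> 0" and "piv b = piv x" and "piv x \<le> k"
  shows "(x - (x $ piv x / b $ piv x) *s b) $ k = 0"
  using assms piv_nonzero[OF assms(1)] nth_eq_0_if_piv_less[of x k] nth_eq_0_if_piv_less[of b k]
  by (cases "k = piv x") auto

lemma span_eq_by_pivots:
  fixes S B :: "('a::field^'n::{finite,linorder}) set"
  assumes S: "vec.subspace S" and "B \<subseteq> S" and "0 \<notin> B"
    and piv_in_B: "\<And>x. x \<in> S \<Longrightarrow> x \<noteq> 0 \<Longrightarrow> \<exists>b\<in>B. piv b = piv x"
  shows "vec.span B = S"
proof
  show "vec.span B \<subseteq> S" using assms by (simp add: vec.span_minimal)
  show "S \<subseteq> vec.span B"
  proof
    fix x assume "x \<in> S"
    then show "x \<in> vec.span B"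
      \<comment> \<open>the measure counts the indices up to the pivot, and is 0 for x = 0\<close>
    proof (induction x rule: measure_induct_rule[where f = "\<lambda>x. card {k. \<exists>i\<ge>k. x $ i \<noteq> 0}"])
      case (less x)
      show ?case
      proof (cases "x = 0")
        case False
        then obtain b where b: "b \<in> B" "piv b = piv x" using piv_in_B less.prems by blast
        let ?p = "piv x"
        define x' where "x' = x - (x $ ?p / b $ ?p) *s b"
        have "x' \<in> S"
          unfolding x'_def using b \<open>B \<subseteq> S\<close> less.prems
          by (blast intro: vec.subspace_diff vec.subspace_scale S)
        have x'_above: "x' $ k = 0" if "?p \<le> k" for k
          unfolding x'_def using b \<open>0 \<notin> B\<close> that by (intro nth_pivot_elimination_eq_0) auto
        have "{k. \<exists>i\<ge>k. x' $ i \<noteq> 0} \<subseteq> {k. k < ?p}"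
        proof safe
          fix k i assume "k \<le> i" "x' $ i \<noteq> 0"
          then show "k < ?p" using x'_above[of i] by (meson not_less order.trans)
        qed
        also have "\<dots> \<subset> {k. \<exists>i\<ge>k. x $ i \<noteq> 0}"
          using piv_nonzero[OF False] by (auto intro: less_imp_le)
        finally have "card {k. \<exists>i\<ge>k. x' $ i \<noteq> 0} < card {k. \<exists>i\<ge>k. x $ i \<noteq> 0}"
          by (rule psubset_card_mono[rotated]) simp
        with less.IH \<open>x' \<in> S\<close> have "x' \<in> vec.span B" by blast
        then have "x' + (x $ ?p / b $ ?p) *s b \<in> vec.span B"
          using b(1) by (simp add: vec.span_add vec.span_base vec.span_scale)
        then show ?thesis by (simp add: x'_def)
      qed (simp add: vec.span_zero)
    qed
  qed
qed

lemma permutes_UNIV_ge_imp_id: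
  fixes p :: "'n::{finite,linorder} \<Rightarrow> 'n"
  assumes p: "p permutes UNIV" and ge: "\<And>i. i \<le> p i"
  shows "p = id"
proof (rule ccontr)
  assume "p \<noteq> id"
  define m where "m = Max {i. p i \<noteq> i}"
  have "{i. p i \<noteq> i} \<noteq> {}" using \<open>p \<noteq> id\<close> by auto
  then have moved: "p m \<noteq> m" unfolding m_def using Max_in[of "{i. p i \<noteq> i}"] by auto
  have top: "i \<le> m" if "p i \<noteq> i" for i unfolding m_def using that by (intro Max_ge) auto
  have "m < p m" using ge[of m] moved by simp
  then have "p (p m) = p m" using top[of "p m"] by force
  then have "p m = m" using permutes_inj[OF p] by (simp add: inj_eq)
  with moved show False by simp
qed

lemma det_upper_triangular:
  fixes V :: "'a::comm_ring_1^'n::{finite,linorder}^'n::{finite,linorder}"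
  assumes "upper_triangular V"
  shows "det V = (\<Prod>i\<in>UNIV. V $ i $ i)"
proof -
  have "(\<Prod>i\<in>UNIV. V $ i $ p i) = 0" if p: "p permutes UNIV" "p \<noteq> id" for p
  proof -
    obtain i where "p i < i" using permutes_UNIV_ge_imp_id[OF p(1)] p(2) by (meson not_le)
    then show ?thesis using assms by (intro prod_zero) (auto simp: upper_triangular_def)
  qed
  then have "det V = of_int (sign (id :: 'n \<Rightarrow> 'n)) * (\<Prod>i\<in>UNIV. V $ i $ id i)"
    unfolding det_def by (subst sum.mono_neutral_right[where S = "{id}"]) (auto simp: permutes_id finite_permutations)
  then show ?thesis by (simp add: sign_id)
qed

lemma invertible_upper_triangular_diag_nonzero:
  fixes V :: "'a::field^'n::{finite,linorder}^'n::{finite,linorder}"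
  assumes "upper_triangular V" and "invertible V"
  shows "V $ j $ j \<noteq> 0"
  using assms invertible_det_nz[of V] by (auto simp: det_upper_triangular)

lemma piv_upper_triangular_mult:
  fixes V :: "'a::field^'n::{finite,linorder}^'n::{finite,linorder}"
  assumes V: "upper_triangular V" and diag: "\<And>j. V $ j $ j \<noteq> 0" and "y \<noteq> 0"
  shows "piv (V *v y) = piv y"
proof (rule piv_eqI)
  let ?m = "piv y"
  have entry: "(V *v y) $ k = (\<Sum>l\<in>UNIV. V $ k $ l * y $ l)" for k
    by (simp add: matrix_vector_mult_def)
  have vanish: "V $ k $ l * y $ l = 0" if "l < k \<or> ?m < l" for k l
    using that V nth_eq_0_if_piv_less[of y l] by (auto simp: upper_triangular_def)
  show "(V *v y) $ k = 0" if "?m < k" for k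
    unfolding entry using that vanish by (intro sum.neutral) (meson leI le_less_trans)
  have "(\<Sum>l\<in>UNIV - {?m}. V $ ?m $ l * y $ l) = 0"
    by (intro sum.neutral ballI vanish) (auto simp: neq_iff)
  then have "(V *v y) $ ?m = V $ ?m $ ?m * y $ ?m"
    unfolding entry by (simp add: sum.remove[of UNIV ?m])
  then show "(V *v y) $ ?m \<noteq> 0" using diag piv_nonzero[OF \<open>y \<noteq> 0\<close>] by simp
qed

lemma piv_column_upper_triangular:
  fixes V :: "'a::field^'n::{finite,linorder}^'n::{finite,linorder}"
  assumes "upper_triangular V" and "\<And>j. V $ j $ j \<noteq> 0"
  shows "piv (column j V) = j"
  using piv_upper_triangular_mult[OF assms, of "axis j 1"] by (simp add: column_eq_mult_axis)

lemma reduced_kernel_nth_eq_0: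
  fixes R :: "'a::field^'n^'m::{finite,linorder}"
  assumes "reduced R" and "R *v y = 0" and "column l R \<noteq> 0"
  shows "y $ l = 0"
proof -
  let ?J = "{l. column l R \<noteq> 0}"
  have "(\<Sum>l\<in>?J. y $ l *s column l R) = R *v y"
    unfolding matrix_mult_sum by (rule sum.mono_neutral_left) auto
  then have "\<forall>l\<in>?J. y $ l = 0"
    using assms(1,2) by (intro distinct_pivots_lincomb_eq_0) (auto simp: reduced_def inj_on_def)
  with assms(3) show ?thesis by blast
qed

lemma column_piv_cycle_eq_0:
  fixes D V :: "'a::field^'n::{finite,linorder}^'n::{finite,linorder}"
  assumes V: "upper_triangular V" "invertible V" and "reduced (D ** V)"
    and "D *v x = 0" and "x \<noteq> 0"
  shows "column (piv x) (D ** V) = 0"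
proof -
  obtain V' where "V ** V' = mat 1" using V(2) by (auto simp: invertible_def)
  then have x: "x = V *v (V' *v x)" by (simp add: matrix_vector_mul_assoc)
  define y where "y = V' *v x"
  have "y \<noteq> 0" using x \<open>x \<noteq> 0\<close> by (auto simp: y_def)
  have "piv x = piv y"
    using x piv_upper_triangular_mult[OF V(1) _ \<open>y \<noteq> 0\<close>] invertible_upper_triangular_diag_nonzero[OF V]
    by (simp add: y_def)
  have "(D ** V) *v y = 0" using \<open>D *v x = 0\<close> x by (simp add: y_def matrix_vector_mul_assoc[symmetric])
  then show ?thesis
    using reduced_kernel_nth_eq_0[OF \<open>reduced (D ** V)\<close>] piv_nonzero[OF \<open>y \<noteq> 0\<close>] \<open>piv x = piv y\<close>
    by metis
qed

lemma span_axis: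
  "vec.span ((\<lambda>i. axis i (1::'a::field)) ` S) = {x :: 'a^'n. \<forall>i. i \<notin> S \<longrightarrow> x $ i = 0}"
proof
  show "vec.span ((\<lambda>i. axis i 1) ` S) \<subseteq> {x. \<forall>i. i \<notin> S \<longrightarrow> x $ i = 0}"
    by (rule vec.span_minimal) (auto simp: vec.subspace_def axis_def)
  show "{x. \<forall>i. i \<notin> S \<longrightarrow> x $ i = 0} \<subseteq> vec.span ((\<lambda>i. axis i (1::'a)) ` S)"
  proof
    fix x :: "'a^'n" assume x: "x \<in> {x. \<forall>i. i \<notin> S \<longrightarrow> x $ i = 0}"
    have "x = (\<Sum>i\<in>UNIV. x $ i *s axis i 1)" by (simp add: basis_expansion)
    also have "\<dots> = (\<Sum>i\<in>S. x $ i *s axis i 1)"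
      by (rule sum.mono_neutral_right) (use x in auto)
    also have "\<dots> \<in> vec.span ((\<lambda>i. axis i 1) ` S)"
      by (intro vec.span_sum vec.span_scale vec.span_base) auto
    finally show "x \<in> vec.span ((\<lambda>i. axis i 1) ` S)" .
  qed
qed

lemma filt_compat_ordered_axis_mem_iff:
  fixes M :: "nat \<Rightarrow> ('a::field^'n::{finite,linorder}) set"
  assumes M: "filt_compat_ordered_basis N M (\<lambda>j. axis j 1)" and "t \<le> N" and "x \<noteq> 0"
  shows "x \<in> M t \<longleftrightarrow> axis (piv x) 1 \<in> M t"
proof -
  let ?S = "{j. axis j 1 \<in> M t}"
  have Mt: "M t = {x. \<forall>i. i \<notin> ?S \<longrightarrow> x $ i = 0}"
    using M \<open>t \<le> N\<close> by (auto simp: filt_compat_ordered_basis_def filt_compat_basis_def span_axis)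
  have down: "k \<in> ?S" if "k \<le> k'" "k' \<in> ?S" for k k'
    using M that \<open>t \<le> N\<close> unfolding filt_compat_ordered_basis_def supp_def by blast
  have "x \<in> M t \<longleftrightarrow> (\<forall>i. i \<notin> ?S \<longrightarrow> x $ i = 0)" by (subst Mt) simp
  also have "\<dots> \<longleftrightarrow> piv x \<in> ?S"
  proof
    show "piv x \<in> ?S" if "\<forall>i. i \<notin> ?S \<longrightarrow> x $ i = 0"
      using that piv_nonzero[OF \<open>x \<noteq> 0\<close>] by blast
    show "\<forall>i. i \<notin> ?S \<longrightarrow> x $ i = 0" if "piv x \<in> ?S"
      using that down le_piv[of x] by blast
  qed
  finally show ?thesis by simp
qed

lemma subspace_filt_compat_basis:
  assumes "filt_compat_basis N M I b" and "t \<le> N"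
  shows "vec.subspace (M t)"
proof -
  have "vec.span (b ` {i\<in>I. b i \<in> M t}) = M t"
    using assms by (simp add: filt_compat_basis_def)
  then show ?thesis using vec.subspace_span[of "b ` {i\<in>I. b i \<in> M t}"] by simp
qed

lemma filt_compat_basis_by_pivots:
  fixes M :: "nat \<Rightarrow> ('a::field^'n::{finite,linorder}) set"
  assumes M: "filt_compat_ordered_basis N M (\<lambda>j. axis j 1)" and Z: "vec.subspace Z"
    and in_Z: "\<And>i. i \<in> I \<Longrightarrow> w i \<in> Z" and nonzero: "\<And>i. i \<in> I \<Longrightarrow> w i \<noteq> 0"
    and inj: "inj_on (\<lambda>i. piv (w i)) I"
    and piv_in: "\<And>x. x \<in> Z \<Longrightarrow> x \<noteq> 0 \<Longrightarrow> \<exists>i\<in>I. piv (w i) = piv x"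
  shows "filt_compat_basis N (\<lambda>t. M t \<inter> Z) I w"
  unfolding filt_compat_basis_def
proof (intro conjI allI impI)
  show "inj_on w I" using inj by (auto simp: inj_on_def)
  fix t assume "t \<le> N"
  let ?B = "w ` {i\<in>I. w i \<in> M t \<inter> Z}"
  have "0 \<notin> ?B" using nonzero by auto
  moreover have "inj_on piv ?B" using inj by (auto simp: inj_on_def)
  ultimately show "vec.independent ?B" by (rule independent_distinct_pivots)
  show "vec.span ?B = M t \<inter> Z"
  proof (rule span_eq_by_pivots)
    have "vec.subspace (M t)"
      using M subspace_filt_compat_basis[OF _ \<open>t \<le> N\<close>] unfolding filt_compat_ordered_basis_def by blast
    then show "vec.subspace (M t \<inter> Z)" using Z by (rule vec.subspace_inter)
    show "?B \<subseteq> M t \<inter> Z" "0 \<notin> ?B" using nonzero by auto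
    fix x assume x: "x \<in> M t \<inter> Z" "x \<noteq> 0"
    then obtain i where i: "i \<in> I" "piv (w i) = piv x" using piv_in by blast
    have "axis (piv (w i)) 1 \<in> M t"
      using filt_compat_ordered_axis_mem_iff[OF M \<open>t \<le> N\<close> x(2)] x(1) i(2) by simp
    then have "w i \<in> M t"
      using filt_compat_ordered_axis_mem_iff[OF M \<open>t \<le> N\<close> nonzero[OF i(1)]] by blast
    then show "\<exists>b\<in>?B. piv b = piv x" using i in_Z by auto
  qed
qed

definition cycle_basis_index ::
  "('a::zero)^'n::{finite,linorder}^'n::{finite,linorder} \<Rightarrow> 'a^'n::{finite,linorder}^'k
    \<Rightarrow> ('n::{finite,linorder} + 'n::{finite,linorder}) set" where
  "cycle_basis_index P R = {Inl j | j. column j P \<noteq> 0} \<union> {Inr j | j. column j R = 0 \<and> j \<notin> pivs P}"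

definition cycle_basis :: "'a^'n^'m \<Rightarrow> 'a^'n^'m \<Rightarrow> 'n + 'n \<Rightarrow> 'a^'m" where
  "cycle_basis P V i = (case i of Inl j \<Rightarrow> column j P | Inr j \<Rightarrow> column j V)"

lemma cycle_basis_kernel:
  fixes D P V :: "'a::comm_semiring_1^'n::{finite,linorder}^'n::{finite,linorder}"
  assumes "D ** P = 0" and "i \<in> cycle_basis_index P (D ** V)"
  shows "D *v cycle_basis P V i = 0"
proof -
  have "D *v column j P = column j (D ** P)" "D *v column j V = column j (D ** V)" for j
    by (simp_all add: column_matrix_matrix_mult)
  moreover have "column j (0 :: 'a^'n::{finite,linorder}^'n::{finite,linorder}) = 0" for j
    by (simp add: column_def vec_eq_iff)
  ultimately show ?thesis
    using assms by (auto simp: cycle_basis_index_def cycle_basis_def)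
qed

lemma filt_compat_basis_cycles:
  fixes D V P :: "'a::field^'n::{finite,linorder}^'n::{finite,linorder}"
  assumes C: "filt_compat_ordered_basis N C (\<lambda>j. axis j 1)"
    and V: "upper_triangular V" "invertible V" and R: "reduced (D ** V)"
    and P: "D ** P = 0" "reduced P"
  shows "filt_compat_basis N (\<lambda>t. {x \<in> C t. D *v x = 0})
           (cycle_basis_index P (D ** V)) (cycle_basis P V)"
proof -
  let ?I = "cycle_basis_index P (D ** V)" and ?w = "cycle_basis P V"
  have piv_V: "piv (column j V) = j" for j
    using piv_column_upper_triangular[OF V(1)] invertible_upper_triangular_diag_nonzero[OF V] by blast
  have column_V: "column j V \<noteq> 0" for j
    using invertible_upper_triangular_diag_nonzero[OF V] by (auto simp: column_def vec_eq_iff)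
  have "filt_compat_basis N (\<lambda>t. C t \<inter> {x. D *v x = 0}) ?I ?w"
  proof (rule filt_compat_basis_by_pivots[OF C])
    show "vec.subspace {x. D *v x = 0}"
      by (auto simp: vec.subspace_def matrix_vector_right_distrib vector_scalar_commute)
    show "?w i \<in> {x. D *v x = 0}" if "i \<in> ?I" for i using cycle_basis_kernel[OF P(1) that] by simp
    show "?w i \<noteq> 0" if "i \<in> ?I" for i
      using that column_V by (auto simp: cycle_basis_index_def cycle_basis_def)
    show "inj_on (\<lambda>i. piv (?w i)) ?I"
    proof (rule inj_onI)
      have P_inj: "j = k" if "column j P \<noteq> 0" "column k P \<noteq> 0" "piv (column j P) = piv (column k P)" for j k
        using P(2) that unfolding reduced_def by blast
      have pivs_P: "piv (column j P) \<in> pivs P" if "column j P \<noteq> 0" for j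
        using that by (auto simp: pivs_def)
      fix i i' assume "i \<in> ?I" "i' \<in> ?I" "piv (?w i) = piv (?w i')"
      then show "i = i'"
        by (cases i; cases i') (auto simp: cycle_basis_index_def cycle_basis_def piv_V intro: P_inj dest: pivs_P)
    qed
    fix x assume x: "x \<in> {x. D *v x = 0}" "x \<noteq> 0"
    show "\<exists>i\<in>?I. piv (?w i) = piv x"
    proof (cases "piv x \<in> pivs P")
      case True
      then show ?thesis by (force simp: pivs_def cycle_basis_index_def cycle_basis_def)
    next
      case False
      have "column (piv x) (D ** V) = 0" using column_piv_cycle_eq_0[OF V R] x by simp
      with False show ?thesis
        by (intro bexI[of _ "Inr (piv x)"]) (auto simp: cycle_basis_index_def cycle_basis_def piv_V)
    qed
  qed
  moreover have "(\<lambda>t. C t \<inter> {x. D *v x = 0}) = (\<lambda>t. {x \<in> C t. D *v x = 0})" by auto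
  ultimately show ?thesis by simp
qed

lemma matrix_inv_intertwine:
  fixes F D D' :: "'a::field^'n^'n"
  assumes "invertible F" and "F ** D = D' ** F"
  shows "matrix_inv F ** D' = D ** matrix_inv F"
proof -
  note F_inv = matrix_inv_inverse[OF \<open>invertible F\<close>]
  have "matrix_inv F ** D' = matrix_inv F ** (D' ** F) ** matrix_inv F"
    by (simp add: F_inv matrix_mul_assoc[symmetric])
  also have "\<dots> = matrix_inv F ** (F ** D) ** matrix_inv F" by (simp only: assms(2))
  also have "\<dots> = D ** matrix_inv F" by (simp add: F_inv matrix_mul_assoc)
  finally show ?thesis .
qed

lemma filt_compat_basis_image:
  fixes F :: "'a::field^'n^'m"
  assumes F: "inj ((*v) F)" and b: "filt_compat_basis N K I b"
  shows "filt_compat_basis N (\<lambda>t. (*v) F ` K t) I (\<lambda>i. F *v b i)"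
  unfolding filt_compat_basis_def
proof (intro conjI allI impI)
  have hom: "module_hom (*s) (*s) ((*v) F)"
    using matrix_vector_mul_linear_gen unfolding Vector_Spaces.linear_def by blast
  show "inj_on (\<lambda>i. F *v b i) I"
    using b unfolding filt_compat_basis_def inj_on_def by (simp add: inj_eq[OF F])
  fix t assume "t \<le> N"
  have sub: "{i\<in>I. F *v b i \<in> (*v) F ` K t} = {i\<in>I. b i \<in> K t}"
    by (simp add: inj_image_mem_iff[OF F])
  have image: "(\<lambda>i. F *v b i) ` {i\<in>I. b i \<in> K t} = (*v) F ` b ` {i\<in>I. b i \<in> K t}" by auto
  show "vec.independent ((\<lambda>i. F *v b i) ` {i\<in>I. F *v b i \<in> (*v) F ` K t})"
    unfolding sub image using b \<open>t \<le> N\<close> unfolding filt_compat_basis_def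
    by (intro module_hom.independent_injective_image[OF hom] inj_on_subset[OF F]) auto
  show "vec.span ((\<lambda>i. F *v b i) ` {i\<in>I. F *v b i \<in> (*v) F ` K t}) = (*v) F ` K t"
    unfolding sub image module_hom.span_image[OF hom] using b \<open>t \<le> N\<close>
    by (simp add: filt_compat_basis_def)
qed

theorem lemma3p8:
  fixes N :: nat
    and D D' F V V\<phi> :: "('a::field)^'n::{finite,linorder}^'n::{finite,linorder}"
    and C C' :: "nat \<Rightarrow> ('a^'n::{finite,linorder}) set"
  assumes "filtration_cc N D C" and "filtration_cc N D' C'"
    and "filt_compat_ordered_basis N C (\<lambda>j. axis j 1)"
    and "filt_compat_ordered_basis N C' (\<lambda>j. axis j 1)"
    and "inj_filt_morphism N D C D' C' F"
    and "invertible F"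
    and "upper_triangular V" and "invertible V"
    and "upper_triangular V\<phi>" and "invertible V\<phi>"
    and "reduced (D ** V)"
    and "reduced ((matrix_inv F ** D') ** V\<phi>)"
  shows "let R = D ** V; R\<phi> = (matrix_inv F ** D') ** V\<phi>;
             Z = (\<lambda>t. (*v) F ` {x \<in> C t. D *v x = 0});
             I = {Inl j | j. column j (F ** R\<phi>) \<noteq> 0}
                 \<union> {Inr j | j. column j R = 0 \<and> j \<notin> pivs R\<phi>};
             z = (\<lambda>i. case i of Inl j \<Rightarrow> column j (F ** R\<phi>) | Inr j \<Rightarrow> F *v column j V)
         in filt_compat_basis N Z I z
            \<and> (\<forall>i\<in>I. supp N Z (z i) = supp N C (matrix_inv F *v z i))"
proof -
  define P where "P = (matrix_inv F ** D') ** V\<phi>"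
  have "F ** D = D' ** F" using assms(5) by (simp add: inj_filt_morphism_def)
  with \<open>invertible F\<close> have "P = D ** (matrix_inv F ** V\<phi>)"
    by (simp add: P_def matrix_inv_intertwine matrix_mul_assoc)
  moreover have "D ** D = 0" using assms(1) by (simp add: filtration_cc_def chain_complex_def)
  ultimately have "D ** P = 0" by (simp add: matrix_mul_assoc)
  have cycles: "filt_compat_basis N (\<lambda>t. {x \<in> C t. D *v x = 0})
      (cycle_basis_index P (D ** V)) (cycle_basis P V)"
    using filt_compat_basis_cycles[OF assms(3,7,8,11) \<open>D ** P = 0\<close>] assms(12) by (simp add: P_def)
  have inj_F: "inj ((*v) F)" using \<open>invertible F\<close> by (rule inj_matrix_vector_mult)
  have "F *v x = 0 \<longleftrightarrow> x = 0" for x using inj_eq[OF inj_F, of x 0] by simp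
  then have index: "{Inl j | j. column j (F ** P) \<noteq> 0} \<union> {Inr j | j. column j (D ** V) = 0 \<and> j \<notin> pivs P}
      = cycle_basis_index P (D ** V)"
    by (simp add: cycle_basis_index_def column_matrix_matrix_mult)
  have family: "(\<lambda>i. case i of Inl j \<Rightarrow> column j (F ** P) | Inr j \<Rightarrow> F *v column j V)
      = (\<lambda>i. F *v cycle_basis P V i)"
    by (simp add: fun_eq_iff cycle_basis_def column_matrix_matrix_mult split: sum.split)
  have "supp N (\<lambda>t. (*v) F ` {x \<in> C t. D *v x = 0}) (F *v cycle_basis P V i)
      = supp N C (matrix_inv F *v (F *v cycle_basis P V i))"
    if "i \<in> cycle_basis_index P (D ** V)" for i
    using cycle_basis_kernel[OF \<open>D ** P = 0\<close> that]
    by (simp add: supp_def inj_image_mem_iff[OF inj_F] matrix_vector_mul_assoc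
        matrix_inv_inverse[OF \<open>invertible F\<close>])
  then show ?thesis
    using filt_compat_basis_image[OF inj_F cycles] unfolding Let_def P_def[symmetric] index family by simp
qed

end
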